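(* Let $n\ge 1$. The voter basis $\mathcal{V}_n=\{\mathsf{v}_A \mid A\subseteq[n]\}$ has the following properties: (a) $\mathcal{V}_n$ is a basis for the preference space $\mathsf{P}^n$. (b) For every $A\subseteq [n]$ and every $S\subseteq[n]$, the preference ordering $\succeq_{\mathsf{v}_A}$ induced by $\mathsf{v}_A$ is separable on $S$ if and only if $A\subseteq S$ or $A\cap S=\emptyset$. Equivalently, $\mathrm{char}(\mathsf{v}_A)=\{S\subseteq[n] \mid A\subseteq S \text{ or } A\cap S=\emptyset\}$.
   Context: $[n]=\{1,\dots,n\}$. Outcomes are bitstrings $x\in\mathbb{Z}_2^n$; write $\widehat{x}=\{i\in[n] : x_i=1\}$. The preference space $\mathsf{P}^n\cong\mathbb{Q}^{2^n}$ is the rational vector space of vectors $\mathsf{p}$ whose entries $\mathsf{p}(x)\in\mathbb{Q}$ are indexed by the outcomes $x\in\mathbb{Z}_2^n$. For $A\subseteq[n]$, the vector $\mathsf{v}_A\in\mathsf{P}^n$ is defined by $\mathsf{v}_A(x)=1$ if $|\widehat{x}\cap A|$ is even and $\mathsf{v}_A(x)=0$ if $|\widehat{x}\cap A|$ is odd. A vector $\mathsf{p}\in\mathsf{P}^n$ induces the preference ordering $\succeq_{\mathsf{p}}$ on outcomes given by $x\succeq_{\mathsf{p}}y \iff \mathsf{p}(x)\ge\mathsf{p}(y)$. For $S\subseteq[n]$, write $-S=[n]\setminus S$. A partial outcome on $S$ is a bitstring indexed by $S$; $x_Su_{-S}$ denotes the outcome that restricts to $x_S$ on $S$ and to $u_{-S}$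 on $-S$; $0_{-S}$ is the all-zero partial outcome on $-S$. The set $S$ is separable with respect to $\succeq$ (equivalently, $\succeq$ is separable on $S$) when for all partial outcomes $x_S,y_S$ on $S$ and all $v_{-S}$ on $-S$: $x_S0_{-S}\succeq y_S0_{-S} \iff x_Sv_{-S}\succeq y_Sv_{-S}$. Finally $\mathrm{char}(\mathsf{p})=\mathrm{char}(\succeq_{\mathsf{p}})$ is the collection of all $S\subseteq[n]$ that are separable with respect to $\succeq_{\mathsf{p}}$. *)

theory Defs
  imports "HOL-Analysis.Analysis" "HOL-Library.Z2"
begin

text \<open>
  The index set \<open>[n]\<close> is the universe of a finite type \<open>'n\<close> with \<open>n = CARD('n)\<close>, and
  \<open>n \<ge> 1\<close> holds because types are nonempty. Outcomes form \<open>bit ^ 'n\<close>, and the preference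
  space is \<open>rat ^ (bit ^ 'n)\<close> with scalar multiplication \<open>(*s)\<close> over the field \<open>rat\<close>, so that
  its linear algebra is that of the locale interpretation \<open>vec\<close>.
\<close>

instance bit :: finite
proof
  have "(UNIV :: bit set) = {0, 1}"
    by auto
  then show "finite (UNIV :: bit set)"
    by (metis finite.emptyI finite.insertI)
qed

type_synonym 'n outcome = "(bit, 'n) vec"
type_synonym 'n preference = "(rat, 'n outcome) vec"

definition ones :: "'n::finite outcome \<Rightarrow> 'n set" where
  "ones x = {i. x $ i = 1}"

definition voter_vec :: "'n::finite set \<Rightarrow> 'n preference" where
  "voter_vec A = (\<chi> x. if even (card (ones x \<inter> A)) then 1 else 0)"

definition voter_basis :: "'n::finite preference set" where
  "voter_basis = {voter_vec A | A. A \<subseteq> UNIV}"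

definition pref_order :: "'n::finite preference \<Rightarrow> 'n outcome \<Rightarrow> 'n outcome \<Rightarrow> bool" where
  "pref_order p x y \<longleftrightarrow> p $ x \<ge> p $ y"

text \<open>
  A partial outcome on \<open>S\<close> is represented by any outcome extending it: \<open>combine S x u\<close> is
  \<open>x\<^sub>S u\<^bsub>-S\<^esub>\<close> and depends on \<open>x\<close> only inside \<open>S\<close> and on \<open>u\<close> only outside \<open>S\<close>. Hence
  quantifying over all \<open>x\<close>, \<open>y\<close>, \<open>v\<close> below ranges over all partial outcomes
  \<open>x\<^sub>S\<close>, \<open>y\<^sub>S\<close>, \<open>v\<^bsub>-S\<^esub>\<close>.
\<close>

definition combine :: "'n::finite set \<Rightarrow> 'n outcome \<Rightarrow> 'n outcome \<Rightarrow> 'n outcome" where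
  "combine S x u = (\<chi> i. if i \<in> S then x $ i else u $ i)"

definition separable_on ::
    "('n::finite outcome \<Rightarrow> 'n outcome \<Rightarrow> bool) \<Rightarrow> 'n set \<Rightarrow> bool" where
  "separable_on R S \<longleftrightarrow>
     (\<forall>x y v. R (combine S x 0) (combine S y 0) \<longleftrightarrow> R (combine S x v) (combine S y v))"

definition character :: "'n::finite preference \<Rightarrow> 'n set set" where
  "character p = {S. separable_on (pref_order p) S}"

end

theory Submission
  imports Defs
begin

text \<open>
  Up to an affine change, \<open>v\<^sub>A\<close> is the character \<open>x \<mapsto> (-1)\<^bsup>\<bar>x \<inter> A\<bar>\<^esup> = 2 v\<^sub>A(x) - v\<^bsub>\<emptyset>\<^esub>(x)\<close>
  of the group of outcomes. Fourier inversion writes every unit vector as a combination of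
  characters, so the \<open>2\<^sup>n\<close> voter vectors span and, by counting dimensions, are independent.
  If \<open>i \<in> A \<inter> S\<close> and \<open>j \<in> A - S\<close>, then flipping bit \<open>j\<close> reverses the preference
  between the two settings of bit \<open>i\<close>, so \<open>S\<close> is not separable.
\<close>

text \<open>As a product over \<open>A\<close>, the sign becomes summable over all \<open>A\<close>
  with \<open>prod_add\<close>.\<close>

lemma minus_one_power_card_Int:
  fixes X A :: "'a::finite set"
  shows "(-1) ^ card (X \<inter> A) = (\<Prod>i\<in>A. if i \<in> X then - 1 else 1 :: 'b::comm_ring_1)"
  by (simp add: prod.If_cases Int_commute)

text \<open>Summing \<open>prod s A\<close> over all \<open>A\<close> expands the product of the
  factors \<open>s i + 1\<close>. A factor is 2 where \<open>X\<close> and \<open>Y\<close> agree at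
  \<open>i\<close> and 0 where they differ.\<close>

lemma sum_characters_orthogonal:
  fixes X Y :: "'a::finite set"
  shows "(\<Sum>A\<in>UNIV. (-1) ^ card (X \<inter> A) * (-1) ^ card (Y \<inter> A)) =
         (if X = Y then 2 ^ CARD('a) else 0 :: 'b::idom)"
proof -
  define s where "s i = (if i \<in> X then - 1 else 1) * (if i \<in> Y then - 1 else 1 :: 'b)" for i
  have "(\<Sum>A\<in>UNIV. (-1) ^ card (X \<inter> A) * (-1) ^ card (Y \<inter> A)) = (\<Sum>A\<in>Pow UNIV. prod s A)"
    unfolding minus_one_power_card_Int s_def by (simp add: prod.distrib)
  also have "\<dots> = (\<Prod>i\<in>UNIV. s i + 1)"
    by (subst prod_add) auto
  also have "\<dots> = (if X = Y then 2 ^ CARD('a) else 0)"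
  proof (cases "X = Y")
    case True
    then have "s i + 1 = 2" for i
      by (simp add: s_def)
    then show ?thesis
      using True by simp
  next
    case False
    then obtain i where "(i \<in> X) \<noteq> (i \<in> Y)"
      by blast
    then have "s i + 1 = 0"
      by (auto simp: s_def)
    then show ?thesis
      using False by (auto simp: prod_zero_iff)
  qed
  finally show ?thesis .
qed

lemma ones_inject: "ones x = ones y \<longleftrightarrow> x = y"
proof
  assume "ones x = ones y"
  then have "x $ i = 1 \<longleftrightarrow> y $ i = 1" for i
    by (auto simp: ones_def)
  then show "x = y"
    by (metis (full_types) bit_not_one_iff vec_eq_iff)
qed simp

text \<open>\<open>voter_vec {}\<close> is constantly 1, so the values 1 and 0 become the signs 1
  and -1.\<close>

lemma voter_vec_character:
  "2 * voter_vec A $ x - voter_vec {} $ x = (-1) ^ card (ones x \<inter> A)"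
  by (simp add: voter_vec_def)

lemma span_voter_basis: "vec.span (voter_basis :: 'n::finite preference set) = UNIV"
proof -
  let ?V = "voter_basis :: 'n preference set"
  have voter: "voter_vec A \<in> vec.span ?V" for A
    by (rule vec.span_base) (auto simp: voter_basis_def)
  have axis: "axis y 1 \<in> vec.span ?V" for y :: "'n outcome"
  proof -
    \<comment> \<open>Fourier coefficients of the unit vector at \<open>y\<close>; the denominator
      cancels the diagonal value of the orthogonality sum.\<close>
    define c where "c A = (-1) ^ card (ones y \<inter> A) / (2 ^ CARD('n) :: rat)" for A
    let ?f = "\<Sum>A\<in>UNIV. c A *s (2 *s voter_vec A - voter_vec {})"
    have "?f $ x = axis y 1 $ x" for x
    proof -
      have "?f $ x = (\<Sum>A\<in>UNIV. c A * (2 * voter_vec A $ x - voter_vec {} $ x))"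
        by (simp add: algebra_simps)
      also have "\<dots> = (\<Sum>A\<in>UNIV. (-1) ^ card (ones x \<inter> A) * (-1) ^ card (ones y \<inter> A)) / 2 ^ CARD('n)"
        unfolding voter_vec_character by (simp add: c_def sum_divide_distrib mult.commute)
      finally show ?thesis
        by (simp add: sum_characters_orthogonal ones_inject axis_def)
    qed
    then have "axis y 1 = ?f"
      by (simp add: vec_eq_iff)
    then show ?thesis
      by (auto intro!: vec.span_sum vec.span_scale vec.span_diff voter)
  qed
  have "p \<in> vec.span ?V" for p
    by (subst basis_expansion[symmetric]) (intro vec.span_sum vec.span_scale axis)
  then show ?thesis
    by blast
qed

lemma independent_voter_basis: "vec.independent (voter_basis :: 'n::finite preference set)"
proof (rule vec.card_le_dim_spanning)
  have V: "(voter_basis :: 'n preference set) = range voter_vec"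
    by (auto simp: voter_basis_def)
  show "finite (voter_basis :: 'n preference set)"
    by (simp add: V)
  \<comment> \<open>The dimension is the number of outcomes, which equals the number of sets
    \<open>A\<close> because \<open>bit\<close> has two elements.\<close>
  have "(UNIV :: bit set) = {0, 1}"
    by auto
  then have "CARD(bit) = 2"
    by (metis card_2_iff zero_neq_one)
  moreover have "card (range (voter_vec :: 'n set \<Rightarrow> _)) \<le> CARD('n set)"
    by (rule card_image_le) simp
  ultimately show "card (voter_basis :: 'n preference set) \<le> vec.dim (UNIV :: 'n preference set)"
    by (simp add: V card_cart_basis)
qed (simp_all add: span_voter_basis)

lemma voter_vec_cong:
  assumes "\<And>i. i \<in> A \<Longrightarrow> x $ i = y $ i"
  shows "voter_vec A $ x = voter_vec A $ y"
proof -
  have "ones x \<inter> A = ones y \<inter> A"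
    using assms by (auto simp: ones_def)
  then show ?thesis
    by (simp add: voter_vec_def)
qed

lemma separable_on_voter_vec:
  "separable_on (pref_order (voter_vec A)) S \<longleftrightarrow> A \<subseteq> S \<or> A \<inter> S = {}"
proof
  assume sep: "separable_on (pref_order (voter_vec A)) S"
  show "A \<subseteq> S \<or> A \<inter> S = {}"
  proof (rule ccontr)
    assume "\<not> (A \<subseteq> S \<or> A \<inter> S = {})"
    then obtain i j where ij: "i \<in> A" "i \<in> S" "j \<in> A" "j \<notin> S"
      by blast
    then have "i \<noteq> j"
      by blast
    \<comment> \<open>With bit \<open>j\<close> off, the parities are even and odd, so the values
      are 1 and 0; with \<open>j\<close> on, they are 0 and 1.\<close>
    have "ones (combine S 0 0) \<inter> A = {}" "ones (combine S (axis i 1) 0) \<inter> A = {i}"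
      "ones (combine S 0 (axis j 1)) \<inter> A = {j}"
      "ones (combine S (axis i 1) (axis j 1)) \<inter> A = {i, j}"
      using ij by (auto simp: ones_def combine_def axis_def split: if_splits)
    then have "pref_order (voter_vec A) (combine S 0 0) (combine S (axis i 1) 0)"
      "\<not> pref_order (voter_vec A) (combine S 0 (axis j 1)) (combine S (axis i 1) (axis j 1))"
      using \<open>i \<noteq> j\<close> by (simp_all add: pref_order_def voter_vec_def)
    with sep show False
      unfolding separable_on_def by blast
  qed
next
  assume "A \<subseteq> S \<or> A \<inter> S = {}"
  then show "separable_on (pref_order (voter_vec A)) S"
  proof
    assume "A \<subseteq> S"
    \<comment> \<open>The part outside \<open>S\<close> cannot influence the comparison.\<close>
    then have "voter_vec A $ combine S x u = voter_vec A $ x" for x u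
      by (intro voter_vec_cong) (auto simp: combine_def)
    then show ?thesis
      by (simp add: separable_on_def pref_order_def)
  next
    assume "A \<inter> S = {}"
    \<comment> \<open>Outcomes that agree outside \<open>S\<close> are always tied, so both sides of
      the equivalence hold.\<close>
    then have "voter_vec A $ combine S x u = voter_vec A $ u" for x u
      by (intro voter_vec_cong) (auto simp: combine_def)
    then show ?thesis
      by (simp add: separable_on_def pref_order_def)
  qed
qed

theorem theorem1p5:
  shows "(vec.independent (voter_basis :: 'n::finite preference set) \<and>
          vec.span (voter_basis :: 'n preference set) = UNIV) \<and>
         (\<forall>(A :: 'n set) (S :: 'n set).
            separable_on (pref_order (voter_vec A)) S \<longleftrightarrow> A \<subseteq> S \<or> A \<inter> S = {}) \<and>
         (\<forall>A :: 'n set. character (voter_vec A) = {S. A \<subseteq> S \<or> A \<inter> S = {}})"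
  by (simp add: independent_voter_basis span_voter_basis separable_on_voter_vec character_def)

end
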